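(* For every integer $n\geq 2$, the graph $G(L(\Pi_n))$ has a Hamiltonian cycle, where $\Pi_n$ is the permutahedron.
   Context: The permutahedron $\Pi_n$ is the convex hull of $\{(\pi(1),\ldots,\pi(n)) : \pi\in S_n\}$; it is $(n-1)$-dimensional. Its nonempty faces correspond to ordered set partitions $A_1|\cdots|A_k$ of $[n]$ (a $k$-block partition is an $(n-k)$-dimensional face), and two nonempty faces are in a cover relation iff the partitions differ by merging two consecutive blocks into one. For a polytope $P$, $L(P)$ is the inclusion order of all faces of $P$ (including $\emptyset$, of dimension $-1$, and $P$), and $G(L(P))$ is its cover graph, with edges between $F\subset F'$ with $\dim F'=\dim F+1$. *)

theory Defs
  imports "HOL-Analysis.Analysis" "Graph_Theory.Graph_Theory"
begin

text \<open>The finite type \<open>'n\<close> plays the role of the index set $[n]$, so $n$ is \<^term>\<open>CARD('n)\<close>.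
  The set does not depend on how \<open>'n\<close> is identified with $[n]$.\<close>

definition permutahedron :: "(real ^ 'n) set" where
  "permutahedron =
     convex hull {(\<chi> i. real (\<pi> i)) | \<pi>. bij_betw \<pi> (UNIV :: 'n set) {1..CARD('n)}}"

text \<open>Faces are taken in the sense of \<^const>\<open>face_of\<close>, which for polytopes agrees with faces cut
  out by supporting hyperplanes, and counts both the empty set (with \<^const>\<open>aff_dim\<close> equal
  to $-1$) and \<open>P\<close> itself.\<close>

definition face_covers :: "'a::euclidean_space set \<Rightarrow> ('a set \<times> 'a set) set" where
  "face_covers P =
     {(F, F'). F face_of P \<and> F' face_of P \<and> F \<subset> F' \<and> aff_dim F' = aff_dim F + 1}"

text \<open>Undirected edges are encoded as pairs of opposite arcs, as in \<^locale>\<open>pair_graph\<close>.\<close>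

definition face_cover_graph :: "'a::euclidean_space set \<Rightarrow> 'a set pair_pre_digraph" where
  "face_cover_graph P =
     \<lparr>pverts = {F. F face_of P}, parcs = face_covers P \<union> (face_covers P)\<inverse>\<rparr>"

text \<open>The length bound excludes loops and walks back and forth along a single edge, which
  \<^const>\<open>pre_digraph.cycle\<close> admits.\<close>

definition hamiltonian_cycle :: "('a, 'b) pre_digraph \<Rightarrow> 'b awalk \<Rightarrow> bool" where
  "hamiltonian_cycle G p \<longleftrightarrow>
     pre_digraph.cycle G p \<and> 3 \<le> length p \<and> tail G ` set p = verts G"

end

theory Submission
  imports Defs
begin

text \<open>A linear functional is maximised over the permutations exactly by those that are monotone in
  its coefficients, so the nonempty faces correspond to ordered partitions. Merging two consecutive
  blocks strictly enlarges the face; as a vertex has dimension \<open>0\<close> and the whole polytope dimension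
  at most \<open>n - 1\<close>, every single merge must raise the dimension by exactly one.

  A new element \<open>x\<close> can be inserted into an ordered partition \<open>A\<close> as a new block or into an existing
  block, and these insertions in left-to-right order form a path from \<open>{x} | A\<close> to \<open>A | {x}\<close>. If
  \<open>A\<close> and \<open>A'\<close> are adjacent, so are the corresponding ends of their paths. Hence a Hamiltonian path
  on the ordered partitions of \<open>S\<close> yields one for \<open>S\<close> with \<open>x\<close> added by running through these paths
  alternately forwards and backwards. Both ends of the resulting path are vertices of the
  permutahedron, so the empty face closes it to a cycle.\<close>

section \<open>A Hamiltonian path on ordered partitions\<close>

fun ordered_partition :: "'a set \<Rightarrow> 'a set list \<Rightarrow> bool" where
  "ordered_partition S [] \<longleftrightarrow> S = {}"
| "ordered_partition S (B # Bs) \<longleftrightarrow> B \<noteq> {} \<and> B \<subseteq> S \<and> ordered_partition (S - B) Bs"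

definition merge_step :: "'a set list \<Rightarrow> 'a set list \<Rightarrow> bool" where
  "merge_step A A' \<longleftrightarrow> (\<exists>us B C vs. A = us @ B # C # vs \<and> A' = us @ (B \<union> C) # vs)"

definition merge_adj :: "'a set list \<Rightarrow> 'a set list \<Rightarrow> bool" where
  "merge_adj A A' \<longleftrightarrow> merge_step A A' \<or> merge_step A' A"

lemma merge_adj_sym: "merge_adj A A' \<longleftrightarrow> merge_adj A' A"
  by (auto simp: merge_adj_def)

lemma merge_step_Cons: "merge_step A A' \<Longrightarrow> merge_step (B # A) (B # A')"
  unfolding merge_step_def by (metis append_Cons)

lemma merge_step_append: "merge_step A A' \<Longrightarrow> merge_step (A @ Bs) (A' @ Bs)"
  unfolding merge_step_def by fastforce

lemma merge_adj_Cons: "merge_adj A A' \<Longrightarrow> merge_adj (B # A) (B # A')"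
  by (auto simp: merge_adj_def merge_step_Cons)

lemma merge_adj_append: "merge_adj A A' \<Longrightarrow> merge_adj (A @ Bs) (A' @ Bs)"
  by (auto simp: merge_adj_def merge_step_append)

lemma merge_adj_insert_left: "merge_adj ({x} # B # Bs) (insert x B # Bs)"
  unfolding merge_adj_def merge_step_def
  by (metis append_Nil insert_is_Un)

lemma merge_adj_insert_right: "merge_adj (insert x B # Bs) (B # {x} # Bs)"
proof -
  have "merge_step (B # {x} # Bs) (insert x B # Bs)"
    unfolding merge_step_def by (rule exI[of _ "[]"]) auto
  then show ?thesis by (simp add: merge_adj_def)
qed

section \<open>Inserting and erasing one element\<close>

fun insertions :: "'a \<Rightarrow> 'a set list \<Rightarrow> 'a set list list" where
  "insertions x [] = [[{x}]]"
| "insertions x (B # Bs) = ({x} # B # Bs) # (insert x B # Bs) # map ((#) B) (insertions x Bs)"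

lemma insertions_neq_Nil [simp]: "insertions x A \<noteq> []"
  by (cases A) auto

lemma hd_insertions [simp]: "hd (insertions x A) = {x} # A"
  by (cases A) auto

lemma last_insertions [simp]: "last (insertions x A) = A @ [{x}]"
  by (induction A) (auto simp: last_map)

text \<open>Each recursion level adds two edges: from \<open>{x} # B # Bs\<close> to
  \<open>insert x B # Bs\<close>, and from there to \<open>B # {x} # Bs\<close>, the first entry of
  the mapped list. The other edges come from the induction, prefixed by \<open>B\<close>.\<close>

lemma successively_insertions: "successively merge_adj (insertions x A)"
  by (induction A)
    (auto simp: successively_Cons successively_map hd_map merge_adj_insert_left
      merge_adj_insert_right intro: successively_mono merge_adj_Cons)

text \<open>Left inverse of insertion: it tells in whose insertion list a partition lies. The filter
  drops the block left empty when \<open>x\<close> stood alone.\<close>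

definition erase :: "'a \<Rightarrow> 'a set list \<Rightarrow> 'a set list" where
  "erase x C = filter (\<lambda>B. B \<noteq> {}) (map (\<lambda>B. B - {x}) C)"

lemma erase_notin:
  "ordered_partition S A \<Longrightarrow> x \<notin> S \<Longrightarrow> erase x A = A"
  by (induction A arbitrary: S) (auto simp: erase_def)

lemma erase_insertions:
  "ordered_partition S A \<Longrightarrow> x \<notin> S \<Longrightarrow> C \<in> set (insertions x A) \<Longrightarrow> erase x C = A"
proof (induction A arbitrary: S C)
  case Nil
  then show ?case by (simp add: erase_def)
next
  case (Cons B Bs)
  have B: "x \<notin> B" "B \<noteq> {}" "ordered_partition (S - B) Bs" using Cons.prems by auto
  then have e: "erase x Bs = Bs"
    using erase_notin Cons.prems(2) by (metis DiffD1)
  consider "C = {x} # B # Bs" | "C = insert x B # Bs"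
    | D where "C = B # D" "D \<in> set (insertions x Bs)"
    using Cons.prems(3) by auto
  then show ?case
  proof cases
    case 3
    then have "erase x D = Bs" using Cons.IH B Cons.prems(2) by auto
    with 3 B show ?thesis by (auto simp: erase_def)
  qed (use B e in \<open>auto simp: erase_def\<close>)
qed

lemma ordered_partition_insertions:
  "ordered_partition S A \<Longrightarrow> x \<notin> S \<Longrightarrow> C \<in> set (insertions x A)
    \<Longrightarrow> ordered_partition (insert x S) C"
proof (induction A arbitrary: S C)
  case (Cons B Bs)
  have B: "x \<notin> B" "B \<noteq> {}" "B \<subseteq> S" "ordered_partition (S - B) Bs" using Cons.prems by auto
  have d: "insert x S - B = insert x (S - B)" "insert x S - insert x B = S - B"
    "insert x S - {x} = S"
    using B Cons.prems(2) by auto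
  consider "C = {x} # B # Bs" | "C = insert x B # Bs"
    | D where "C = B # D" "D \<in> set (insertions x Bs)"
    using Cons.prems(3) by auto
  then show ?case
  proof cases
    case 3
    then have "ordered_partition (insert x (S - B)) D" using Cons.IH B Cons.prems(2) by auto
    with 3 B show ?thesis by (auto simp: d)
  qed (use B in \<open>auto simp: d\<close>)
qed auto

text \<open>Taking \<open>x\<close> out shrinks its block or removes it, and putting
  \<open>x\<close> back at that place is one of the insertions. Hence the insertion lists exhaust
  the partitions of \<open>insert x S\<close>.\<close>

lemma ordered_partition_erase:
  "ordered_partition (insert x S) C \<Longrightarrow> x \<notin> S
    \<Longrightarrow> ordered_partition S (erase x C) \<and> C \<in> set (insertions x (erase x C))"
proof (induction C arbitrary: S)
  case (Cons B Bs)
  show ?case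
  proof (cases "x \<in> B")
    case True
    then have *: "insert x S - B = S - (B - {x})" using Cons.prems(2) by auto
    then have p: "ordered_partition (S - (B - {x})) Bs" using Cons.prems by auto
    moreover have "x \<notin> S - (B - {x})" using Cons.prems by auto
    ultimately have e: "erase x Bs = Bs" by (rule erase_notin)
    show ?thesis
    proof (cases "B = {x}")
      case True
      \<comment> \<open>\<open>{x} # Bs\<close> heads \<open>insertions x Bs\<close>, whose defining
        equations depend on whether \<open>Bs\<close> is empty.\<close>
      with p e show ?thesis by (cases Bs) (auto simp: erase_def)
    next
      case False
      have "insert x (B - {x}) = B" using True by auto
      with p e False True Cons.prems show ?thesis by (auto simp: erase_def)
    qed
  next
    case False
    then have *: "insert x S - B = insert x (S - B)" by auto
    have "ordered_partition (S - B) (erase x Bs) \<and> Bs \<in> set (insertions x (erase x Bs))"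
      using Cons.prems by (intro Cons.IH) (auto simp: *)
    with False Cons.prems show ?thesis by (auto simp: erase_def)
  qed
qed auto

text \<open>The three kinds of entries differ in their first block, which is \<open>{x}\<close>,
  \<open>insert x B\<close> or \<open>B\<close>, as \<open>B\<close> is nonempty and misses
  \<open>x\<close>.\<close>

lemma distinct_insertions:
  "ordered_partition S A \<Longrightarrow> x \<notin> S \<Longrightarrow> distinct (insertions x A)"
proof (induction A arbitrary: S)
  case (Cons B Bs)
  then have "distinct (insertions x Bs)" by auto
  moreover have "x \<notin> B" "B \<noteq> {}" using Cons.prems by auto
  ultimately show ?case by (auto simp: distinct_map)
qed auto

section \<open>Concatenating the insertion paths\<close>

fun zigzag :: "bool \<Rightarrow> 'a \<Rightarrow> 'a set list list \<Rightarrow> 'a set list list" where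
  "zigzag b x [] = []"
| "zigzag b x (A # As) =
    (if b then insertions x A else rev (insertions x A)) @ zigzag (\<not> b) x As"

lemma zigzag_eq_Nil [simp]: "zigzag b x As = [] \<longleftrightarrow> As = []"
  by (cases As) auto

lemma hd_zigzag: "As \<noteq> [] \<Longrightarrow> hd (zigzag b x As) = (if b then {x} # hd As else hd As @ [{x}])"
  by (cases As) (auto simp: hd_rev)

text \<open>The side on which \<open>{x}\<close> sits in the last entry depends on \<open>b\<close>
  and the parity of \<open>length As\<close>, but on either side it is one further block.\<close>

lemma length_last_zigzag:
  "As \<noteq> [] \<Longrightarrow> length (last (zigzag b x As)) = Suc (length (last As))"
  by (induction As arbitrary: b) (auto simp: last_rev)

lemma set_zigzag: "set (zigzag b x As) = (\<Union>A\<in>set As. set (insertions x A))"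
  by (induction As arbitrary: b) auto

lemma successively_rev_insertions: "successively merge_adj (rev (insertions x A))"
  unfolding successively_rev
  by (rule successively_mono[OF successively_insertions]) (use merge_adj_sym in blast)

text \<open>Since the direction flips, both entries at a junction carry \<open>{x}\<close> on the
  same side, and adjacency of the underlying partitions carries over.\<close>

lemma successively_zigzag:
  "successively merge_adj As \<Longrightarrow> successively merge_adj (zigzag b x As)"
proof (induction As arbitrary: b)
  case (Cons A As)
  then show ?case
    by (cases "As = []")
      (auto simp: successively_append_iff successively_insertions successively_rev_insertions
        successively_Cons hd_zigzag last_rev merge_adj_Cons merge_adj_append simp del: successively_rev)
qed auto

text \<open>Insertion lists of different partitions are disjoint because \<open>erase x\<close> maps
  each entry back to the partition it came from.\<close>

lemma distinct_zigzag:
  "distinct As \<Longrightarrow> (\<And>A. A \<in> set As \<Longrightarrow> ordered_partition S A) \<Longrightarrow> x \<notin> S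
    \<Longrightarrow> distinct (zigzag b x As)"
proof (induction As arbitrary: b)
  case (Cons A As)
  have "distinct (zigzag (\<not> b) x As)" using Cons by auto
  moreover have "distinct (insertions x A)"
    using Cons.prems distinct_insertions[of S A x] by auto
  moreover have "set (insertions x A) \<inter> set (zigzag (\<not> b) x As) = {}"
  proof (rule ccontr)
    assume "\<not> ?thesis"
    then obtain C A' where "C \<in> set (insertions x A)" "A' \<in> set As" "C \<in> set (insertions x A')"
      by (auto simp: set_zigzag)
    then have "erase x C = A" "erase x C = A'"
      using Cons.prems erase_insertions by (metis list.set_intros)+
    then show False using \<open>A' \<in> set As\<close> Cons.prems(1) by auto
  qed
  ultimately show ?case by auto
qed auto

text \<open>A partition into \<open>card S\<close> blocks consists of singletons, so the length
  conditions make both ends vertices of the polytope. They survive the induction because each end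
  gains the block \<open>{x}\<close>.\<close>

lemma ordered_partitions_path:
  assumes "finite S"
  shows "\<exists>ps. ps \<noteq> [] \<and> distinct ps \<and> set ps = {A. ordered_partition S A}
    \<and> successively merge_adj ps \<and> length (hd ps) = card S \<and> length (last ps) = card S"
  using assms
proof (induction S)
  case empty
  have "{A. ordered_partition {} A} = {[] :: 'a set list}"
  proof -
    have "A = []" if "ordered_partition {} A" for A :: "'a set list"
      using that by (cases A) auto
    then show ?thesis by auto
  qed
  \<comment> \<open>The empty list is the only partition of the empty set, so the path is a single
    point.\<close>
  then show ?case by (intro exI[of _ "[[]]"]) auto
next
  case (insert x S)
  then obtain ps where ps: "ps \<noteq> []" "distinct ps" "set ps = {A. ordered_partition S A}"
    "successively merge_adj ps" "length (hd ps) = card S" "length (last ps) = card S"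
    by auto
  have "set (zigzag True x ps) = {A. ordered_partition (insert x S) A}"
    using ordered_partition_insertions[OF _ insert(2)] ordered_partition_erase[OF _ insert(2)]
    by (auto simp: set_zigzag ps)
  with ps insert show ?case
    by (intro exI[of _ "zigzag True x ps"])
      (auto simp: successively_zigzag length_last_zigzag hd_zigzag
        intro: distinct_zigzag)
qed

section \<open>Faces of the permutahedron\<close>

definition perms :: "('n::finite \<Rightarrow> nat) set" where
  "perms = {\<pi>. bij_betw \<pi> UNIV {1..CARD('n)}}"

definition perm_vec :: "('n::finite \<Rightarrow> nat) \<Rightarrow> real ^ 'n" where
  "perm_vec \<pi> = (\<chi> i. real (\<pi> i))"

lemma permutahedron_eq: "permutahedron = convex hull (perm_vec ` perms)"
  unfolding permutahedron_def perms_def perm_vec_def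
  by (rule arg_cong[where f = "(hull) convex"]) auto

lemma finite_perms: "finite (perms :: ('n::finite \<Rightarrow> nat) set)"
proof (rule finite_subset)
  show "perms \<subseteq> (UNIV :: 'n set) \<rightarrow>\<^sub>E {1..CARD('n)}"
    by (auto simp: perms_def bij_betw_def)
qed (auto intro: finite_PiE)

lemma perms_nonempty: "perms \<noteq> ({} :: ('n::finite \<Rightarrow> nat) set)"
proof -
  obtain h :: "'n \<Rightarrow> nat" where "bij_betw h UNIV {1..CARD('n)}"
    using finite_same_card_bij[of "UNIV :: 'n set" "{1..CARD('n)}"] by auto
  then show ?thesis by (auto simp: perms_def)
qed

text \<open>Where \<open>w\<close> is constant the order of the values is free, so only the sequence
  of level sets of \<open>w\<close> matters.\<close>

definition monotone_perms :: "('n::finite \<Rightarrow> 'b::linorder) \<Rightarrow> ('n \<Rightarrow> nat) set" where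
  "monotone_perms w = {\<pi> \<in> perms. \<forall>i j. w i < w j \<longrightarrow> \<pi> i < \<pi> j}"

definition weight :: "('n::finite \<Rightarrow> real) \<Rightarrow> ('n \<Rightarrow> nat) \<Rightarrow> real" where
  "weight w \<pi> = (\<Sum>i\<in>UNIV. w i * real (\<pi> i))"

lemma inner_perm_vec: "vec_lambda w \<bullet> perm_vec \<pi> = weight w \<pi>"
  by (simp add: inner_vec_def perm_vec_def weight_def)

lemma perms_transpose: "\<pi> \<in> perms \<Longrightarrow> \<pi> \<circ> Transposition.transpose i j \<in> perms"
  by (simp add: perms_def bij_betw_trans[OF bij_transpose])

text \<open>Only the summands at \<open>i\<close> and \<open>j\<close> change. The sign of the
  product drives the exchange argument; a tie \<open>w i = w j\<close> leaves the weight
  unchanged.\<close>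

lemma weight_transpose:
  assumes "i \<noteq> j"
  shows "weight w (\<pi> \<circ> Transposition.transpose i j) = weight w \<pi> + (w i - w j) * (real (\<pi> j) - real (\<pi> i))"
proof -
  have split: "(\<Sum>k\<in>UNIV. f k) = f i + f j + (\<Sum>k\<in>UNIV - {i,j}. f k)" for f :: "'a \<Rightarrow> real"
    using assms sum.subset_diff[of "{i,j}" UNIV f] by simp
  have "(\<Sum>k\<in>UNIV - {i,j}. w k * real ((\<pi> \<circ> Transposition.transpose i j) k))
      = (\<Sum>k\<in>UNIV - {i,j}. w k * real (\<pi> k))"
    by (intro sum.cong) auto
  then show ?thesis
    unfolding weight_def split by (simp add: algebra_simps)
qed

lemma perms_inj: "\<pi> \<in> perms \<Longrightarrow> \<pi> i = \<pi> j \<longleftrightarrow> i = j"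
  by (auto simp: perms_def bij_betw_def inj_on_def)

text \<open>Exchange argument: if \<open>w i < w j\<close> but \<open>\<pi> j < \<pi> i\<close>,
  both factors in \<open>weight_transpose\<close> are negative, so swapping would increase the
  weight.\<close>

lemma max_weight_imp_monotone:
  assumes "\<pi> \<in> perms" "\<And>\<sigma>. \<sigma> \<in> perms \<Longrightarrow> weight w \<sigma> \<le> weight w \<pi>"
  shows "\<pi> \<in> monotone_perms w"
proof -
  have "\<pi> i < \<pi> j" if "w i < w j" for i j
  proof (rule ccontr)
    assume "\<not> \<pi> i < \<pi> j"
    moreover have "i \<noteq> j" using that by auto
    ultimately have "\<pi> j < \<pi> i" using perms_inj[OF assms(1), of i j] by linarith
    then have "(w i - w j) * (real (\<pi> j) - real (\<pi> i)) > 0"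
      using that by (intro mult_neg_neg) auto
    then show False
      using assms(2)[OF perms_transpose[OF assms(1), of i j]] weight_transpose[OF \<open>i \<noteq> j\<close>, of w \<pi>]
      by linarith
  qed
  then show ?thesis using assms(1) by (auto simp: monotone_perms_def)
qed

text \<open>A monotone permutation lists the values of \<open>w\<close> in sorted order, and the sorted list depends
  on \<open>w\<close> alone.\<close>

lemma monotone_perms_weight_eq:
  fixes w :: "'n::finite \<Rightarrow> real"
  assumes "\<pi> \<in> monotone_perms w" "\<sigma> \<in> monotone_perms w"
  shows "weight w \<pi> = weight w \<sigma>"
proof -
  let ?N = "{1..CARD('n)}"
  \<comment> \<open>\<open>f \<pi> m\<close> is the coefficient of the index to which
    \<open>\<pi>\<close> assigns the value \<open>m\<close>, which turns the weight into a sum over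
    values.\<close>
  define f where "f \<pi> = w \<circ> inv_into UNIV \<pi>" for \<pi> :: "'n \<Rightarrow> nat"
  have key: "map (f \<pi>) [1..<Suc CARD('n)] = sorted_list_of_multiset (image_mset w (mset_set UNIV))
     \<and> weight w \<pi> = (\<Sum>m\<in>?N. f \<pi> m * real m)"
    if "\<pi> \<in> monotone_perms w" for \<pi>
  proof -
    have bij: "bij_betw \<pi> UNIV ?N" and mono: "\<And>i j. w i < w j \<Longrightarrow> \<pi> i < \<pi> j"
      using that by (auto simp: monotone_perms_def perms_def)
    then have inj: "inj \<pi>" and img: "range \<pi> = ?N" by (auto simp: bij_betw_def)
    have fp: "f \<pi> (\<pi> i) = w i" for i by (simp add: f_def inv_f_f[OF inj])
    have le: "f \<pi> a \<le> f \<pi> b" if ab: "a \<in> ?N" "b \<in> ?N" "a \<le> b" for a b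
    proof (rule ccontr)
      have "a \<in> range \<pi>" "b \<in> range \<pi>" using ab img by simp_all
      then obtain i j where ij: "a = \<pi> i" "b = \<pi> j" by blast
      assume "\<not> ?thesis"
      then have "w j < w i" unfolding ij fp by simp
      then have "\<pi> j < \<pi> i" by (rule mono)
      then show False using ab(3) unfolding ij by simp
    qed
    let ?xs = "map (f \<pi>) [1..<Suc CARD('n)]"
    have sorted: "sorted ?xs"
      unfolding sorted_wrt_map
      by (rule sorted_wrt_mono_rel[OF _ sorted_wrt_upt]) (auto intro!: le simp del: upt_Suc)
    have "mset [1..<Suc CARD('n)] = mset_set ?N"
      using mset_upt[of 1 "Suc CARD('n)"] by (simp only: atLeastLessThanSuc_atLeastAtMost)
    also have "\<dots> = image_mset \<pi> (mset_set UNIV)"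
      using image_mset_mset_set[OF inj] img by simp
    finally have "mset ?xs = image_mset w (mset_set UNIV)"
      unfolding mset_map by (simp only: multiset.map_comp comp_def fp)
    then have 1: "?xs = sorted_list_of_multiset (image_mset w (mset_set UNIV))"
      using sorted_list_of_multiset_mset[of ?xs] sorted_sort_id[OF sorted] by (simp only:)
    have "weight w \<pi> = (\<Sum>i\<in>UNIV. f \<pi> (\<pi> i) * real (\<pi> i))"
      by (simp add: weight_def fp)
    also have "\<dots> = (\<Sum>m\<in>?N. f \<pi> m * real m)"
      by (rule sum.reindex_bij_betw[OF bij])
    finally show ?thesis using 1 by blast
  qed
  have "map (f \<pi>) [1..<Suc CARD('n)] = map (f \<sigma>) [1..<Suc CARD('n)]"
    using key[OF assms(1)] key[OF assms(2)] by metis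
  then have "f \<pi> m = f \<sigma> m" if "m \<in> ?N" for m
    using that by (simp del: upt_Suc)
  then show ?thesis using key[OF assms(1)] key[OF assms(2)] by (metis (no_types, lifting) sum.cong)
qed

lemma monotone_perms_nonempty: "monotone_perms (w :: 'n::finite \<Rightarrow> real) \<noteq> {}"
proof -
  have "Max (weight w ` perms) \<in> weight w ` perms"
    by (intro Max_in) (auto simp: finite_perms perms_nonempty)
  then obtain \<pi> where "\<pi> \<in> perms" "weight w \<pi> = Max (weight w ` perms)" by auto
  then have "\<pi> \<in> monotone_perms w"
    by (intro max_weight_imp_monotone) (auto simp: finite_perms)
  then show ?thesis by auto
qed

text \<open>Some maximiser exists and is monotone by the exchange argument; all monotone
  permutations share its weight.\<close>

lemma monotone_iff_max_weight:
  fixes w :: "'n::finite \<Rightarrow> real"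
  assumes "\<pi> \<in> perms"
  shows "\<pi> \<in> monotone_perms w \<longleftrightarrow> weight w \<pi> = Max (weight w ` perms)"
proof
  have "Max (weight w ` perms) \<in> weight w ` perms"
    by (intro Max_in) (auto simp: finite_perms perms_nonempty)
  then obtain \<sigma> where \<sigma>: "\<sigma> \<in> perms" "weight w \<sigma> = Max (weight w ` perms)" by auto
  then have "\<sigma> \<in> monotone_perms w"
    by (intro max_weight_imp_monotone) (auto simp: finite_perms)
  moreover assume "\<pi> \<in> monotone_perms w"
  ultimately show "weight w \<pi> = Max (weight w ` perms)"
    using \<sigma>(2) monotone_perms_weight_eq by metis
next
  assume "weight w \<pi> = Max (weight w ` perms)"
  then show "\<pi> \<in> monotone_perms w"
    by (intro max_weight_imp_monotone assms) (auto simp: finite_perms)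
qed

section \<open>Faces as hulls of maximising permutations\<close>

definition monotone_face :: "('n::finite \<Rightarrow> 'b::linorder) \<Rightarrow> (real ^ 'n) set" where
  "monotone_face w = convex hull (perm_vec ` monotone_perms w)"

text \<open>A face of the hull of finitely many points is the hull of some of them. Those lie in
  \<open>F\<close> and hence in \<open>H\<close>; conversely every generator in \<open>H\<close>
  lies in \<open>F\<close>.\<close>

lemma exposed_face_eq_hull:
  assumes "F face_of permutahedron" "F = permutahedron \<inter> H"
  shows "F = convex hull (perm_vec ` {\<pi> \<in> perms. perm_vec \<pi> \<in> H})"
proof -
  have V: "F face_of convex hull (perm_vec ` perms)" "compact (perm_vec ` perms)"
    using assms by (auto simp: permutahedron_eq finite_perms finite_imp_compact)
  then obtain S where S: "S \<subseteq> perm_vec ` perms" "F = convex hull S"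
    by (metis face_of_convex_hull_subset)
  have "S \<subseteq> F" using S hull_subset by metis
  have "S \<subseteq> perm_vec ` {\<pi> \<in> perms. perm_vec \<pi> \<in> H}"
  proof
    fix x assume "x \<in> S"
    moreover from this obtain \<pi> where "\<pi> \<in> perms" "x = perm_vec \<pi>" using S(1) by auto
    moreover have "x \<in> H" using \<open>x \<in> S\<close> \<open>S \<subseteq> F\<close> assms(2) by auto
    ultimately show "x \<in> perm_vec ` {\<pi> \<in> perms. perm_vec \<pi> \<in> H}" by simp
  qed
  then have "F \<subseteq> convex hull (perm_vec ` {\<pi> \<in> perms. perm_vec \<pi> \<in> H})"
    using S(2) hull_mono by metis
  moreover have "perm_vec ` {\<pi> \<in> perms. perm_vec \<pi> \<in> H} \<subseteq> F"
    using assms(2) by (auto simp: permutahedron_eq hull_inc)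
  then have "convex hull (perm_vec ` {\<pi> \<in> perms. perm_vec \<pi> \<in> H}) \<subseteq> F"
    using face_of_imp_convex[OF V(1)] by (rule hull_minimal)
  ultimately show ?thesis by auto
qed

lemma inner_le_Max_weight:
  assumes "x \<in> permutahedron"
  shows "vec_lambda w \<bullet> x \<le> Max (weight w ` perms)"
proof -
  have "convex hull (perm_vec ` perms) \<subseteq> {x. vec_lambda w \<bullet> x \<le> Max (weight w ` perms)}"
    by (intro hull_minimal) (auto simp: inner_perm_vec finite_perms convex_halfspace_le)
  then show ?thesis using assms by (auto simp: permutahedron_eq)
qed

text \<open>The maximum weight bounds the functional on the whole polytope, so the hyperplane is
  supporting, and the generators on it are the maximisers.\<close>

lemma monotone_face_eq:
  fixes w :: "'n::finite \<Rightarrow> real"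
  shows "permutahedron \<inter> {x. vec_lambda w \<bullet> x = Max (weight w ` perms)} = monotone_face w" (is "?F = _")
    and "monotone_face w face_of permutahedron"
proof -
  have *: "?F face_of permutahedron"
    by (intro face_of_Int_supporting_hyperplane_le inner_le_Max_weight)
      (auto simp: permutahedron_eq)
  have "{\<pi> \<in> perms. perm_vec \<pi> \<in> {x. vec_lambda w \<bullet> x = Max (weight w ` perms)}} = monotone_perms w"
    using monotone_iff_max_weight[of _ w] by (auto simp: inner_perm_vec monotone_perms_def)
  with exposed_face_eq_hull[OF * refl] show eq: "?F = monotone_face w" by (simp add: monotone_face_def)
  show "monotone_face w face_of permutahedron" using * unfolding eq .
qed

text \<open>The hull lies in the supporting hyperplane, so it contains no further permutation
  points. Faces can therefore be compared through their sets of permutations.\<close>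

lemma perm_vec_in_monotone_face:
  fixes w :: "'n::finite \<Rightarrow> real"
  assumes "\<pi> \<in> perms"
  shows "perm_vec \<pi> \<in> monotone_face w \<longleftrightarrow> \<pi> \<in> monotone_perms w"
  using assms monotone_iff_max_weight[OF assms, of w]
  by (auto simp: monotone_face_eq(1)[symmetric] inner_perm_vec permutahedron_eq hull_inc)

text \<open>Faces of a polytope are exposed, and the normal vector of a supporting hyperplane serves
  as \<open>w\<close>.\<close>

lemma face_of_permutahedron:
  fixes F :: "(real ^ 'n::finite) set"
  assumes "F face_of permutahedron" "F \<noteq> {}"
  shows "\<exists>w :: 'n \<Rightarrow> real. F = monotone_face w"
proof -
  have "polytope (permutahedron :: (real ^ 'n) set)"
    unfolding permutahedron_eq polytope_def using finite_perms by blast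
  then have "F exposed_face_of permutahedron"
    using assms(1) exposed_face_of_polyhedron polytope_imp_polyhedron by blast
  then obtain a b where ab: "permutahedron \<subseteq> {x. a \<bullet> x \<le> b}" "F = permutahedron \<inter> {x. a \<bullet> x = b}"
    unfolding exposed_face_of_def by blast
  let ?w = "vec_nth a"
  have F: "F = convex hull (perm_vec ` {\<pi> \<in> perms. weight ?w \<pi> = b})"
    using exposed_face_eq_hull[OF assms(1) ab(2)] inner_perm_vec[of ?w] by simp
  \<comment> \<open>As the face is nonempty, some permutation attains \<open>b\<close>, which makes
    the bound \<open>b\<close> the maximum weight.\<close>
  obtain \<pi> where \<pi>: "\<pi> \<in> perms" "weight ?w \<pi> = b" 
  proof -
    have "{\<pi> \<in> perms. weight ?w \<pi> = b} \<noteq> {}"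
      using F assms(2) by (metis convex_hull_empty image_empty)
    then show ?thesis using that by auto
  qed
  have "weight ?w \<sigma> \<le> b" if "\<sigma> \<in> perms" for \<sigma>
  proof -
    have "perm_vec \<sigma> \<in> permutahedron" using that by (simp add: permutahedron_eq hull_inc)
    then show ?thesis using ab(1) inner_perm_vec[of ?w \<sigma>] by auto
  qed
  then have "Max (weight ?w ` perms) = b"
    using \<pi> by (intro Max_eqI) (auto simp: finite_perms)
  then have "F = monotone_face ?w"
    using monotone_face_eq(1)[of ?w] ab(2) by simp
  then show ?thesis by blast
qed

section \<open>Ordered partitions and the orders they induce\<close>

text \<open>Counts the blocks before the first one containing \<open>i\<close>, or all blocks if
  there is none. Its values are real so that it can serve as the coefficients of a
  functional.\<close>

primrec block_index :: "'a set list \<Rightarrow> 'a \<Rightarrow> real" where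
  "block_index [] i = 0"
| "block_index (B # Bs) i = (if i \<in> B then 0 else 1 + block_index Bs i)"

lemma block_index_nonneg: "block_index A i \<ge> 0"
  by (induction A) auto

text \<open>The blocks are the level sets of \<open>w\<close> in increasing order: the first
  collects the minimisers on \<open>S\<close>, the others come from the induction on
  \<open>S - B\<close>.\<close>

lemma ex_block_index_order:
  fixes w :: "'a \<Rightarrow> real"
  assumes "finite S"
  shows "\<exists>A. ordered_partition S A \<and>
    (\<forall>i\<in>S. \<forall>j\<in>S. block_index A i < block_index A j \<longleftrightarrow> w i < w j)"
  using assms
proof (induction S rule: finite_psubset_induct)
  case (psubset S)
  show ?case
  proof (cases "S = {}")
    case True
    then show ?thesis by (intro exI[of _ "[]"]) auto
  next
    case False
    define B where "B = {i \<in> S. w i = Min (w ` S)}"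
    have le: "Min (w ` S) \<le> w i" if "i \<in> S" for i using psubset(1) that by simp
    have "Min (w ` S) \<in> w ` S" using psubset(1) False by simp
    then have B: "B \<noteq> {}" "B \<subseteq> S" by (auto simp: B_def)
    then have "S - B \<subset> S" by auto
    then obtain Bs where Bs: "ordered_partition (S - B) Bs"
      "\<forall>i\<in>S - B. \<forall>j\<in>S - B. block_index Bs i < block_index Bs j \<longleftrightarrow> w i < w j"
      using psubset(2) by blast
    have "block_index (B # Bs) i < block_index (B # Bs) j \<longleftrightarrow> w i < w j"
      if "i \<in> S" "j \<in> S" for i j
    proof (cases "i \<in> B \<or> j \<in> B")
      case True
      then show ?thesis
        using le[OF that(1)] le[OF that(2)] that block_index_nonneg[of Bs i]
          block_index_nonneg[of Bs j]
        by (auto simp: B_def)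
    next
      case False
      then show ?thesis using Bs(2) that by simp
    qed
    moreover have "ordered_partition S (B # Bs)" using Bs(1) B by simp
    ultimately show ?thesis by blast
  qed
qed

text \<open>Indices are \<open>0\<close> on the nonempty first block and at least \<open>1\<close>
  elsewhere. Hence the order alone determines the first block.\<close>

lemma block_index_minimal:
  assumes "ordered_partition S (B # Bs)"
  shows "B = {i \<in> S. \<forall>j\<in>S. \<not> block_index (B # Bs) j < block_index (B # Bs) i}"
proof -
  obtain b where "b \<in> B" "b \<in> S" using assms by auto
  then have "\<exists>j\<in>S. block_index (B # Bs) j < block_index (B # Bs) i" if "i \<notin> B" for i
    using that block_index_nonneg[of Bs i] by (intro bexI[of _ b]) auto
  moreover have "\<not> block_index (B # Bs) j < block_index (B # Bs) i" if "i \<in> B" for i j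
    using that block_index_nonneg[of "B # Bs" j] by auto
  moreover have "B \<subseteq> S" using assms by simp
  ultimately show ?thesis by blast
qed

text \<open>Peel off the common first block; on \<open>S - B\<close> both indices are shifted by
  one, which preserves comparisons.\<close>

lemma block_index_order_inj:
  assumes "ordered_partition S A" "ordered_partition S A'"
    and "\<And>i j. i \<in> S \<Longrightarrow> j \<in> S \<Longrightarrow>
      block_index A i < block_index A j \<longleftrightarrow> block_index A' i < block_index A' j"
  shows "A = A'"
  using assms
proof (induction A arbitrary: A' S)
  case Nil
  from Nil.prems(1,2) show ?case by (cases A') auto
next
  case (Cons B Bs)
  from Cons.prems(1,2) obtain B' Bs' where A': "A' = B' # Bs'" by (cases A') auto
  have "B = {i \<in> S. \<forall>j\<in>S. \<not> block_index (B # Bs) j < block_index (B # Bs) i}"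
    by (rule block_index_minimal[OF Cons.prems(1)])
  also have "\<dots> = {i \<in> S. \<forall>j\<in>S. \<not> block_index A' j < block_index A' i}"
    by (intro Collect_cong conj_cong ball_cong refl) (simp only: Cons.prems(3))
  also have "\<dots> = B'"
    using Cons.prems(2) unfolding A' by (rule block_index_minimal[symmetric])
  finally have B: "B' = B" ..
  have "Bs = Bs'"
  proof (rule Cons.IH)
    show "block_index Bs i < block_index Bs j \<longleftrightarrow> block_index Bs' i < block_index Bs' j"
      if "i \<in> S - B" "j \<in> S - B" for i j
      using Cons.prems(3)[of i j] that by (simp add: A' B)
  qed (use Cons.prems(1,2) in \<open>auto simp: A' B\<close>)
  then show ?case by (simp add: A' B)
qed

text \<open>Merging ties the elements of \<open>B\<close> and \<open>C\<close> and lowers all later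
  indices by one, so strict comparisons can only be lost.\<close>

lemma block_index_merge:
  assumes "merge_step A A'" "block_index A' i < block_index A' j"
  shows "block_index A i < block_index A j"
proof -
  obtain us B C vs where "A = us @ B # C # vs" "A' = us @ (B \<union> C) # vs"
    using assms(1) by (auto simp: merge_step_def)
  moreover have "block_index (us @ B # C # vs) i < block_index (us @ B # C # vs) j"
    if "block_index (us @ (B \<union> C) # vs) i < block_index (us @ (B \<union> C) # vs) j"
    using that
  proof (induction us)
    case Nil
    then show ?case
      using block_index_nonneg[of vs i] block_index_nonneg[of vs j] by (auto split: if_splits)
  next
    case (Cons U us)
    then show ?case
      using block_index_nonneg[of "us @ B # C # vs" j]
        block_index_nonneg[of "us @ (B \<union> C) # vs" i]
      by (auto split: if_splits)
  qed
  ultimately show ?thesis using assms(2) by simp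
qed

lemma length_merge_step: "merge_step A A' \<Longrightarrow> length A = Suc (length A')"
  by (auto simp: merge_step_def)

text \<open>If \<open>w i = w j\<close>, transposing \<open>i\<close> and \<open>j\<close> preserves
  the maximum weight, so both orders of the two values occur. Thus the monotone permutations
  determine the order induced by \<open>w\<close>.\<close>

lemma less_iff_monotone_perms:
  fixes w :: "'n::finite \<Rightarrow> real"
  shows "w i < w j \<longleftrightarrow> (\<forall>\<pi>\<in>monotone_perms w. \<pi> i < \<pi> j)"
proof
  assume *: "\<forall>\<pi>\<in>monotone_perms w. \<pi> i < \<pi> j"
  obtain \<pi> where \<pi>: "\<pi> \<in> monotone_perms w" using monotone_perms_nonempty[of w] by auto
  then have p: "\<pi> \<in> perms" by (simp add: monotone_perms_def)
  show "w i < w j"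
  proof (rule ccontr)
    assume "\<not> w i < w j"
    moreover have "\<not> w j < w i" using * \<pi> by (fastforce simp: monotone_perms_def)
    ultimately have eq: "w i = w j" by simp
    have "i \<noteq> j" using * \<pi> by auto
    then have "weight w (\<pi> \<circ> Transposition.transpose i j) = weight w \<pi>" by (simp add: weight_transpose eq)
    then have "\<pi> \<circ> Transposition.transpose i j \<in> monotone_perms w"
      using \<pi> monotone_iff_max_weight[OF p] monotone_iff_max_weight[OF perms_transpose[OF p]]
      by metis
    then have "\<pi> j < \<pi> i" using * by fastforce
    then show False using * \<pi> by fastforce
  qed
qed (auto simp: monotone_perms_def)

section \<open>The correspondence between ordered partitions and nonempty faces\<close>

abbreviation partition_face :: "'n::finite set list \<Rightarrow> (real ^ 'n) set" where
  "partition_face A \<equiv> monotone_face (block_index A)"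

lemma monotone_face_subset_iff:
  fixes w w' :: "'n::finite \<Rightarrow> real"
  shows "monotone_face w \<subseteq> monotone_face w' \<longleftrightarrow> monotone_perms w \<subseteq> monotone_perms w'"
proof
  assume *: "monotone_face w \<subseteq> monotone_face w'"
  show "monotone_perms w \<subseteq> monotone_perms w'"
  proof
    fix \<pi> assume "\<pi> \<in> monotone_perms w"
    moreover from this have "\<pi> \<in> perms" by (simp add: monotone_perms_def)
    ultimately show "\<pi> \<in> monotone_perms w'"
      using * perm_vec_in_monotone_face[of \<pi> w] perm_vec_in_monotone_face[of \<pi> w'] by auto
  qed
qed (auto simp: monotone_face_def intro!: hull_mono)

text \<open>The face determines its permutations, these determine the order of the block indices,
  and that order determines the partition.\<close>

lemma inj_partition_face:
  "inj_on partition_face {A. ordered_partition (UNIV :: 'n::finite set) A}"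
proof (rule inj_onI; clarsimp)
  fix A A' :: "'n set list"
  assume A: "ordered_partition UNIV A" "ordered_partition UNIV A'"
    and "partition_face A = partition_face A'"
  then have "monotone_perms (block_index A) = monotone_perms (block_index A')"
    using monotone_face_subset_iff[of "block_index A" "block_index A'"]
      monotone_face_subset_iff[of "block_index A'" "block_index A"] by simp
  then show "A = A'"
    using less_iff_monotone_perms[of "block_index A"] less_iff_monotone_perms[of "block_index A'"]
    by (intro block_index_order_inj[OF A]) (simp only:)
qed

lemma partition_face_surj:
  fixes F :: "(real ^ 'n::finite) set"
  assumes "F face_of permutahedron" "F \<noteq> {}"
  shows "\<exists>A. ordered_partition UNIV A \<and> F = partition_face A"
proof -
  obtain w :: "'n \<Rightarrow> real" where w: "F = monotone_face w"
    using face_of_permutahedron[OF assms] by blast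
  obtain A where A: "ordered_partition UNIV A" "\<forall>i j. block_index A i < block_index A j \<longleftrightarrow> w i < w j"
    using ex_block_index_order[of "UNIV :: 'n set" w] by auto
  then have "monotone_perms w = monotone_perms (block_index A)"
    by (simp add: monotone_perms_def)
  then show ?thesis using A(1) w by (auto simp: monotone_face_def)
qed

lemma partition_face_neq_empty: "partition_face A \<noteq> {}"
  by (simp add: monotone_face_def monotone_perms_nonempty)

text \<open>Fewer strict comparisons leave more monotone permutations; strictness comes from
  injectivity, as the two lists differ in length.\<close>

lemma partition_face_merge_psubset:
  assumes "merge_step A A'" "ordered_partition UNIV A" "ordered_partition UNIV A'"
  shows "partition_face A \<subset> partition_face A'"
proof -
  have "partition_face A \<subseteq> partition_face A'"
    unfolding monotone_face_subset_iff
    using block_index_merge[OF assms(1)] by (auto simp: monotone_perms_def)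
  moreover have "A \<noteq> A'" using length_merge_step[OF assms(1)] by auto
  then have "partition_face A \<noteq> partition_face A'"
    using inj_onD[OF inj_partition_face, of A A'] assms(2,3) by blast
  ultimately show ?thesis by blast
qed

section \<open>Dimensions of the faces\<close>

lemma aff_dim_merge_less:
  assumes "merge_step A A'" "ordered_partition UNIV A" "ordered_partition UNIV A'"
  shows "aff_dim (partition_face A) < aff_dim (partition_face A')"
proof (rule face_of_aff_dim_lt)
  show "convex (partition_face A')" by (simp add: monotone_face_def)
  show "partition_face A face_of partition_face A'"
    using monotone_face_eq(2) psubset_imp_subset[OF partition_face_merge_psubset[OF assms]]
      face_of_imp_subset[OF monotone_face_eq(2)]
    by (rule face_of_subset)
  show "partition_face A \<noteq> partition_face A'"
    using partition_face_merge_psubset[OF assms] by blast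
qed

text \<open>With fewer blocks than elements, some block is not a singleton; a single point is split
  off the first such block.\<close>

lemma ex_split:
  "finite S \<Longrightarrow> ordered_partition S A \<Longrightarrow> length A < card S
    \<Longrightarrow> \<exists>A0. ordered_partition S A0 \<and> merge_step A0 A"
proof (induction A arbitrary: S)
  case (Cons B Bs)
  then have B: "B \<noteq> {}" "B \<subseteq> S" "ordered_partition (S - B) Bs" by auto
  show ?case
  proof (cases "card B = 1")
    case True
    then have "length Bs < card (S - B)"
      using Cons.prems B by (simp add: card_Diff_subset finite_subset)
    then obtain A0 where "ordered_partition (S - B) A0" "merge_step A0 Bs"
      using Cons.IH[of "S - B"] Cons.prems B by auto
    then show ?thesis using B by (intro exI[of _ "B # A0"]) (auto intro: merge_step_Cons)
  next
    case False
    obtain b where b: "b \<in> B" using B by auto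
    have "B - {b} \<noteq> {}"
    proof
      assume "B - {b} = {}"
      then have "B = {b}" using b by auto
      then show False using False by simp
    qed
    moreover have "S - {b} - (B - {b}) = S - B" "{b} \<union> (B - {b}) = B" using b by auto
    ultimately have "ordered_partition S ({b} # (B - {b}) # Bs)"
      "merge_step ({b} # (B - {b}) # Bs) (B # Bs)"
      using B b by (auto simp: merge_step_def intro!: exI[of _ "[]"])
    then show ?thesis by blast
  qed
qed auto

lemma ordered_partition_merge_step:
  assumes "merge_step A A'" "ordered_partition S A"
  shows "ordered_partition S A'"
proof -
  obtain us B C vs where "A = us @ B # C # vs" "A' = us @ (B \<union> C) # vs"
    using assms(1) by (auto simp: merge_step_def)
  moreover have "ordered_partition S (us @ (B \<union> C) # vs)"
    if "ordered_partition S (us @ B # C # vs)" for S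
    using that
  proof (induction us arbitrary: S)
    case Nil
    moreover have "S - (B \<union> C) = S - B - C" by blast
    ultimately show ?case by auto
  qed auto
  ultimately show ?thesis using assms(2) by simp
qed

text \<open>The coordinates of every permutation have the same sum, so the polytope lies in a
  hyperplane.\<close>

lemma aff_dim_permutahedron_le: "aff_dim (permutahedron :: (real ^ 'n::finite) set) \<le> int CARD('n) - 1"
proof -
  let ?H = "{x :: real ^ 'n. 1 \<bullet> x = (\<Sum>k = 1..CARD('n). real k)}"
  have "1 \<bullet> perm_vec \<pi> = (\<Sum>k = 1..CARD('n). real k)" if "\<pi> \<in> perms" for \<pi> :: "'n \<Rightarrow> nat"
    using that sum.reindex_bij_betw[of \<pi> UNIV "{1..CARD('n)}" real]
    by (simp add: inner_vec_def perm_vec_def perms_def)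
  then have "permutahedron \<subseteq> ?H"
    unfolding permutahedron_eq by (intro hull_minimal) (auto simp: convex_hyperplane)
  moreover have "(1 :: real ^ 'n) \<noteq> 0" by (simp add: vec_eq_iff)
  then have "aff_dim ?H = int CARD('n) - 1" by (simp add: aff_dim_hyperplane)
  ultimately show ?thesis using aff_dim_subset[of permutahedron ?H] by linarith
qed

text \<open>Merging the first two blocks repeatedly leads to a single block, where the bound for the
  whole polytope applies; each merge raises the dimension by at least one.\<close>

lemma aff_dim_partition_face_le:
  "ordered_partition UNIV (A :: 'n::finite set list)
    \<Longrightarrow> aff_dim (partition_face A) \<le> int CARD('n) - int (length A)"
proof (induction "length A" arbitrary: A rule: less_induct)
  case less
  consider "A = []" | B where "A = [B]" | B C vs where "A = B # C # vs"
    by (metis neq_Nil_conv)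
  then show ?case
  proof cases
    case 2
    have "aff_dim (partition_face A) \<le> aff_dim (permutahedron :: (real ^ 'n) set)"
      by (rule aff_dim_subset[OF face_of_imp_subset[OF monotone_face_eq(2)]])
    with 2 show ?thesis using aff_dim_permutahedron_le[where 'n = 'n] by simp
  next
    case (3 B C vs)
    let ?A' = "(B \<union> C) # vs"
    have m: "merge_step A ?A'" unfolding merge_step_def 3 by (metis append_Nil)
    then have "ordered_partition UNIV ?A'" using ordered_partition_merge_step less.prems by blast
    then show ?thesis
      using less.hyps[of ?A'] aff_dim_merge_less[OF m less.prems] length_merge_step[OF m]
      by linarith
  \<comment> \<open>The empty list partitions only the empty set, whereas \<open>UNIV\<close> is
    nonempty.\<close>
  qed (use less.prems in simp)
qed

text \<open>Counting from the other end: splitting leads to \<open>CARD('n)\<close> blocks, where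
  nonemptiness gives dimension at least \<open>0\<close>, and each split lowers the dimension by at
  least one.\<close>

lemma aff_dim_partition_face_ge:
  "ordered_partition UNIV (A :: 'n::finite set list)
    \<Longrightarrow> aff_dim (partition_face A) \<ge> int CARD('n) - int (length A)"
proof (induction "CARD('n) - length A" arbitrary: A rule: less_induct)
  case less
  show ?case
  proof (cases "length A < CARD('n)")
    case True
    then obtain A0 where A0: "ordered_partition UNIV A0" "merge_step A0 A"
      using ex_split[OF _ less.prems] by auto
    have len: "length A0 = Suc (length A)" by (rule length_merge_step[OF A0(2)])
    have "aff_dim (partition_face A0) \<ge> int CARD('n) - int (length A0)"
      by (rule less.hyps[OF _ A0(1)]) (use True len in linarith)
    then show ?thesis
      using aff_dim_merge_less[OF A0(2,1) less.prems] len by linarith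
  next
    case False
    have "aff_dim (partition_face A) \<ge> 0"
      using partition_face_neq_empty[of A] aff_dim_negative_iff[of "partition_face A"] by linarith
    then show ?thesis using False by simp
  qed
qed

lemma aff_dim_partition_face:
  "ordered_partition UNIV (A :: 'n::finite set list)
    \<Longrightarrow> aff_dim (partition_face A) = int CARD('n) - int (length A)"
  by (intro antisym aff_dim_partition_face_le aff_dim_partition_face_ge)

lemma merge_step_face_covers:
  assumes "merge_step A A'" "ordered_partition UNIV A" "ordered_partition UNIV A'"
  shows "(partition_face A, partition_face A') \<in> face_covers permutahedron"
  using partition_face_merge_psubset[OF assms] length_merge_step[OF assms(1)]
    aff_dim_partition_face[OF assms(2)] aff_dim_partition_face[OF assms(3)]
  by (simp add: face_covers_def monotone_face_eq(2))

section \<open>The Hamiltonian cycle\<close>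

text \<open>Turns a cyclic list of vertices into a walk given by arcs: with arcs being pairs of
  endpoints, each vertex is paired with its cyclic successor.\<close>

lemma ex_hamiltonian_cycle:
  fixes G :: "('v, 'v \<times> 'v) pre_digraph"
  assumes proj: "tail G = fst" "head G = snd"
    and vs: "distinct vs" "3 \<le> length vs" "set vs = verts G"
    and succ: "successively (\<lambda>u v. (u, v) \<in> arcs G) vs"
    and closing: "(last vs, hd vs) \<in> arcs G"
  shows "\<exists>p. hamiltonian_cycle G p"
proof -
  \<comment> \<open>The final vertex \<open>u\<close> is kept arbitrary because in the induction the
    last arc still returns to the head of the original list.\<close>
  have cas: "vs \<noteq> [] \<Longrightarrow> pre_digraph.cas G (hd vs) (zip vs (tl vs @ [u])) u" for vs u
  proof (induction vs)
    case (Cons a vs)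
    then show ?case by (cases vs) (auto simp: pre_digraph.cas.simps proj)
  qed simp
  have arcs: "vs \<noteq> [] \<Longrightarrow> successively (\<lambda>u v. (u, v) \<in> arcs G) vs \<Longrightarrow> (last vs, u) \<in> arcs G
    \<Longrightarrow> set (zip vs (tl vs @ [u])) \<subseteq> arcs G" for vs u
  proof (induction vs)
    case (Cons a vs)
    then show ?case by (cases vs) auto
  qed simp
  have ne: "vs \<noteq> []" using vs by auto
  let ?p = "zip vs (tl vs @ [hd vs])"
  have len: "length ?p = length vs" using ne by simp
  have p: "?p \<noteq> []" using len ne by auto
  have fst: "map fst ?p = vs" using ne by simp
  have snd: "map snd ?p = tl vs @ [hd vs]" using ne by simp
  have "pre_digraph.awalk G (hd vs) ?p (hd vs)"
    using cas[OF ne] arcs[OF ne succ closing] vs ne by (auto simp: pre_digraph.awalk_def)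
  moreover have "tl (pre_digraph.awalk_verts G (hd vs) ?p) = tl vs @ [hd vs]"
    unfolding pre_digraph.awalk_verts_conv'[OF cas[OF ne]] using p snd by (simp add: proj)
  \<comment> \<open>A cycle requires its vertices after the first to be distinct; here they form a
    rotation of \<open>vs\<close>.\<close>
  moreover have "distinct (tl vs @ [hd vs])" using vs(1) ne by (cases vs) auto
  ultimately have "pre_digraph.cycle G ?p"
    unfolding pre_digraph.cycle_def using p by metis
  moreover have "tail G ` set ?p = verts G"
    using fst vs(3) by (metis proj(1) set_map)
  ultimately show ?thesis
    unfolding hamiltonian_cycle_def using vs(2) len by metis
qed

theorem theorem7:
  assumes "CARD('n::finite) \<ge> 2"
  shows "\<exists>p. hamiltonian_cycle (with_proj (face_cover_graph (permutahedron :: (real ^ 'n) set))) p"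
proof -
  let ?G = "with_proj (face_cover_graph (permutahedron :: (real ^ 'n) set))"
  obtain ps where ps: "ps \<noteq> []" "distinct ps" "set ps = {A. ordered_partition (UNIV :: 'n set) A}"
    "successively merge_adj ps" "length (hd ps) = CARD('n)" "length (last ps) = CARD('n)"
    using ordered_partitions_path[of "UNIV :: 'n set"] by auto
  have arcs: "arcs ?G = face_covers permutahedron \<union> (face_covers permutahedron)\<inverse>"
    and verts: "verts ?G = {F. F face_of permutahedron}"
    by (simp_all add: face_cover_graph_def)
  \<comment> \<open>A partition into \<open>CARD('n)\<close> blocks gives a face of dimension
    \<open>0\<close>, one more than the \<open>-1\<close> of the empty face.\<close>
  have empty_cover: "({}, partition_face A) \<in> face_covers permutahedron"
    if "ordered_partition UNIV A" "length A = CARD('n)" for A :: "'n set list"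
    using aff_dim_partition_face[OF that(1)] that(2) partition_face_neq_empty[of A]
    by (simp add: face_covers_def monotone_face_eq(2) psubset_eq)
  have ends: "ordered_partition UNIV (hd ps)" "ordered_partition UNIV (last ps)"
    using ps(3) hd_in_set[OF ps(1)] last_in_set[OF ps(1)] by blast+
  show ?thesis
  proof (rule ex_hamiltonian_cycle)
    let ?vs = "{} # map partition_face ps"
    have "inj_on partition_face (set ps)" unfolding ps(3) by (rule inj_partition_face)
    moreover have "{} \<notin> set (map partition_face ps)"
      using partition_face_neq_empty by fastforce
    ultimately show "distinct ?vs" using ps(2) by (simp add: distinct_map)
    \<comment> \<open>As \<open>CARD('n)\<close> is at least \<open>2\<close>, the one-block
      partition differs from \<open>hd ps\<close>. Two partitions and the empty face give the
      required three vertices.\<close>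
    have "[UNIV] \<in> set ps" using ps(3) by simp
    moreover have "hd ps \<noteq> [UNIV]"
    proof
      assume "hd ps = [UNIV]"
      then show False using ps(5) assms by simp
    qed
    ultimately have "\<not> length ps \<le> 1" by (cases ps) auto
    then show "3 \<le> length ?vs" by simp
    show "set ?vs = verts ?G"
    proof (intro set_eqI iffI)
      fix F assume "F \<in> set ?vs"
      then show "F \<in> verts ?G" unfolding verts using monotone_face_eq(2) by auto
    next
      fix F assume "F \<in> verts ?G"
      then show "F \<in> set ?vs"
        unfolding verts using partition_face_surj[of F] ps(3) by (cases "F = {}") auto
    qed
    have "successively (\<lambda>A A'. (partition_face A, partition_face A') \<in> arcs ?G) ps"
      using ps(4)
    proof (rule successively_mono)
      fix A A' assume "A \<in> set ps" "A' \<in> set ps" "merge_adj A A'"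
      moreover from this have "ordered_partition UNIV A" "ordered_partition UNIV A'"
        using ps(3) by blast+
      ultimately show "(partition_face A, partition_face A') \<in> arcs ?G"
        unfolding arcs merge_adj_def using merge_step_face_covers by blast
    qed
    moreover have "({}, partition_face (hd ps)) \<in> arcs ?G"
      using empty_cover[OF ends(1) ps(5)] unfolding arcs by blast
    ultimately show "successively (\<lambda>u v. (u, v) \<in> arcs ?G) ?vs"
      using ps(1) by (simp add: successively_Cons successively_map hd_map)
    have "(partition_face (last ps), {}) \<in> arcs ?G"
      using empty_cover[OF ends(2) ps(6)] unfolding arcs by blast
    then show "(last ?vs, hd ?vs) \<in> arcs ?G" using ps(1) by (simp add: last_map)
  qed simp_all
qed

end
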